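(* Consider the linear measurement model $\mathbf{y}=C\mathbf{x}^*+\mathbf{e}+\mathbf{v}$, with $C\in\mathbb{R}^{m\times n}$, $m>n$, $\mathbf{x}^*\in\mathbb{R}^n$ the actual state, $\mathbf{e}\in\mathbb{R}^m$ the attack vector, and $\mathbf{v}\in\mathbb{R}^m$ an error term with $\|\mathbf{v}\|\le\varepsilon$ for a known $\varepsilon>0$. Suppose an estimate $\hat{\mathcal{T}}$ of $\operatorname{supp}(\mathbf{e})$ is given, with uncertainty described by the model in the context. Let $\eta\in(0,1]$, let $$l_\eta=\max\Big\{|\mathcal{I}|\ :\ \mathcal{I}\subseteq\hat{\mathcal{T}}^c,\ \prod_{i\in\mathcal{I}}\mathbf{p}_i\ge\eta\Big\},$$ and let $\hat{\mathcal{T}}_\eta^c$ be the set of the first $l_\eta$ indices obtained by sorting $\{1,\dots,m\}$ in descending order of the entries $\mathbf{p}_i\hat{\mathbf{q}}_i$. Let $\delta>0$ and let $\mathcal{X}\subset\mathbb{R}^n$ satisfy $\|\mathbf{x}_1-\mathbf{x}_2\|\le\delta$ for all $\mathbf{x}_1,\mathbf{x}_2\in\mathcal{X}$, with $\mathbf{x}^*\in\mathcal{X}$. If $l_\eta-|\operatorname{supp}(\mathbf{e})|\ge n$, then, with probability at least $\eta$, the least-square estimator $$\hat{\mathbf{x}}_\eta\in\operatorname{arg\,min}_{\mathbf{x}\in\mathcal{X}}\ \tfrac12\big\|\mathbf{y}_{\hat{\mathcal{T}}_\eta^c}-C_{\hat{\mathcal{T}}_\eta^c}\mathbf{x}\big\|^2$$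 satisfies $$\|\hat{\mathbf{x}}_\eta-\mathbf{x}^*\|\le2\min\left\{\frac{\delta}{2},\ \frac{\varepsilon}{1-\delta_n}\right\},$$ where $\delta_n$ is the $n$-restricted isometry constant of $C^\top$.
   Context: $\|\cdot\|$ is the Euclidean norm. $\operatorname{supp}(\mathbf{e})=\{i:\mathbf{e}_i\ne0\}$. $C_{\mathcal{S}}$ and $\mathbf{y}_{\mathcal{S}}$ denote the rows of $C$ and the entries of $\mathbf{y}$ indexed by $\mathcal{S}$. Complements are in $\{1,\dots,m\}$. The paper's standing assumptions on the model also include that $\mathbf{e}$ is sparse and that $\mathbf{e}^\top\mathbf{v}=0$. Indicator vectors: for $\mathcal{S}\subseteq\{1,\dots,m\}$ the indicator vector has $i$-th entry $0$ if $i\in\mathcal{S}$ and $1$ otherwise. $\mathbf{q}$ is the indicator vector of $\mathcal{T}=\operatorname{supp}(\mathbf{e})$ and $\hat{\mathbf{q}}$ that of $\hat{\mathcal{T}}$. Uncertainty model: $\mathbf{q}_i=\epsilon_i\hat{\mathbf{q}}_i+(1-\epsilon_i)(1-\hat{\mathbf{q}}_i)$, $i=1,\dots,m$, where the $\epsilon_i$ are independent Bernoulli random variables with $\Pr\{\epsilon_i=1\}=\mathbf{p}_i\in(0,1)$; $\hat{\mathbf{q}}$ is fixed, and $\operatorname{supp}(\mathbf{e})$ is random through the $\epsilon_i$. Probability is over the $\epsilon_i$, and the condition $l_\eta-|\operatorname{supp}(\mathbf{e})|\ge n$ is assumed to hold (almost surely). Restricted isometry constant: for a matrix $F$, let $F(\mathcal{S})$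 be the submatrix of columns indexed by $\mathcal{S}$. The $k$-restricted isometry constant $\delta_k$ of $F$ is the smallest number such that $(1-\delta_k)\|\mathbf{w}\|^2\le\|F(\mathcal{S})\mathbf{w}\|^2\le(1+\delta_k)\|\mathbf{w}\|^2$ for all $\mathcal{S}$ with $|\mathcal{S}|\le k$ and all $\mathbf{w}\in\mathbb{R}^{|\mathcal{S}|}$. The quantity $\varepsilon/(1-\delta_n)$ is read as $+\infty$ if $\delta_n\ge1$. The minimizer $\hat{\mathbf{x}}_\eta$ is any minimizer, assumed to exist; ties in the sorting are broken arbitrarily. *)

theory Defs
  imports "HOL-Probability.Probability"
begin

definition vec_supp :: "real ^ 'm \<Rightarrow> 'm set" where
  "vec_supp e = {i. e $ i \<noteq> 0}"

(* Note the convention: 0 on the set, 1 off the set. *)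
definition indicator_vec :: "'m set \<Rightarrow> real ^ 'm" where
  "indicator_vec S = (\<chi> i. if i \<in> S then 0 else 1)"

(* The columns of F indexed by S form F(S); a vector w in R^|S| is given by the values on S
   of a function on all column indices, so that norm w is L2_set w S. *)
definition rip_bound :: "real ^ 'c ^ 'r \<Rightarrow> nat \<Rightarrow> real \<Rightarrow> bool" where
  "rip_bound F k d \<longleftrightarrow>
     (\<forall>S (w :: 'c \<Rightarrow> real). card S \<le> k \<longrightarrow>
        (1 - d) * (L2_set w S)\<^sup>2 \<le> (norm (\<Sum>i\<in>S. w i *\<^sub>R column i F))\<^sup>2 \<and>
        (norm (\<Sum>i\<in>S. w i *\<^sub>R column i F))\<^sup>2 \<le> (1 + d) * (L2_set w S)\<^sup>2)"

lemma rip_boundD: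
  assumes "rip_bound F k d" and "card S \<le> k"
  shows "(1 - d) * (L2_set w S)\<^sup>2 \<le> (norm (\<Sum>i\<in>S. w i *\<^sub>R column i F))\<^sup>2"
    and "(norm (\<Sum>i\<in>S. w i *\<^sub>R column i F))\<^sup>2 \<le> (1 + d) * (L2_set w S)\<^sup>2"
  using assms by (simp_all add: rip_bound_def)

definition rip_const :: "real ^ 'c ^ 'r \<Rightarrow> nat \<Rightarrow> real" where
  "rip_const F k = (LEAST d. rip_bound F k d)"

(* The smallest constant exists (for k = 0 every real number is admissible, so k > 0 is needed). *)
lemma rip_bound_rip_const:
  fixes F :: "real ^ 'c ^ 'r"
  assumes "k > 0"
  shows "rip_bound F k (rip_const F k)"
proof -
  define D where "D = {d. rip_bound F k d}"
  define B where "B = (L2_set (\<lambda>i. norm (column i F)) UNIV)\<^sup>2"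
  have upper: "(norm (\<Sum>i\<in>S. w i *\<^sub>R column i F))\<^sup>2 \<le> B * (L2_set w S)\<^sup>2"
    for S and w :: "'c \<Rightarrow> real"
  proof -
    have "norm (\<Sum>i\<in>S. w i *\<^sub>R column i F) \<le> (\<Sum>i\<in>S. \<bar>w i\<bar> * \<bar>norm (column i F)\<bar>)"
      by (rule order_trans[OF norm_sum]) simp
    also have "\<dots> \<le> L2_set w S * L2_set (\<lambda>i. norm (column i F)) S"
      by (rule L2_set_mult_ineq)
    also have "\<dots> \<le> L2_set w S * L2_set (\<lambda>i. norm (column i F)) UNIV"
      by (intro mult_left_mono L2_set_nonneg)
         (auto simp: L2_set_def intro!: sum_mono2)
    finally have "(norm (\<Sum>i\<in>S. w i *\<^sub>R column i F))\<^sup>2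
        \<le> (L2_set w S * L2_set (\<lambda>i. norm (column i F)) UNIV)\<^sup>2"
      by (intro power_mono) auto
    then show ?thesis
      by (simp add: B_def power_mult_distrib mult.commute)
  qed
  have "rip_bound F k (1 + B)"
    unfolding rip_bound_def
  proof (intro allI impI conjI)
    fix S :: "'c set" and w :: "'c \<Rightarrow> real"
    have "B \<ge> 0" by (simp add: B_def)
    then have "(1 - (1 + B)) * (L2_set w S)\<^sup>2 \<le> 0"
      by (simp add: mult_nonpos_nonneg)
    then show "(1 - (1 + B)) * (L2_set w S)\<^sup>2 \<le> (norm (\<Sum>i\<in>S. w i *\<^sub>R column i F))\<^sup>2"
      by (rule order_trans) simp
    have "B * (L2_set w S)\<^sup>2 \<le> (1 + (1 + B)) * (L2_set w S)\<^sup>2"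
      by (intro mult_right_mono) auto
    with upper[where S = S and w = w]
    show "(norm (\<Sum>i\<in>S. w i *\<^sub>R column i F))\<^sup>2 \<le> (1 + (1 + B)) * (L2_set w S)\<^sup>2"
      by linarith
  qed
  then have ne: "D \<noteq> {}" by (auto simp: D_def)
  have nonneg: "d \<ge> 0" if "d \<in> D" for d
  proof -
    fix c :: 'c
    have "card {c} \<le> k" using assms by simp
    moreover have "rip_bound F k d" using that by (simp add: D_def)
    ultimately have "(1 - d) * (L2_set (\<lambda>_. 1) {c})\<^sup>2 \<le> (1 + d) * (L2_set (\<lambda>_. 1) {c})\<^sup>2"
      using order_trans[OF rip_boundD(1) rip_boundD(2)] by blast
    then show "d \<ge> 0" by (simp add: L2_set_def)
  qed
  then have bdd: "bdd_below D" by (rule bdd_belowI)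
  have "rip_bound F k (Inf D)"
    unfolding rip_bound_def
  proof (intro allI impI)
    fix S :: "'c set" and w :: "'c \<Rightarrow> real"
    assume S: "card S \<le> k"
    define a where "a = (L2_set w S)\<^sup>2"
    define b where "b = (norm (\<Sum>i\<in>S. w i *\<^sub>R column i F))\<^sup>2"
    have ab: "(1 - d) * a \<le> b \<and> b \<le> (1 + d) * a" if "d \<in> D" for d
      using that S by (simp add: D_def a_def b_def rip_boundD)
    have "a \<ge> 0" by (simp add: a_def)
    have "(1 - Inf D) * a \<le> b \<and> b \<le> (1 + Inf D) * a"
    proof (cases "a = 0")
      case True
      obtain d where "d \<in> D" using ne by blast
      from ab[OF this] have "(1 - d) * a \<le> b" "b \<le> (1 + d) * a" by auto
      with True show ?thesis by simp
    next
      case False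
      with \<open>a \<ge> 0\<close> have "a > 0" by simp
      have lower: "1 - b / a \<le> d \<and> b / a - 1 \<le> d" if "d \<in> D" for d
        using ab[OF that] \<open>a > 0\<close> by (simp add: field_simps)
      have "1 - b / a \<le> Inf D" "b / a - 1 \<le> Inf D"
        using lower by (simp_all add: cInf_greatest[OF ne])
      with \<open>a > 0\<close> show ?thesis by (simp add: field_simps)
    qed
    then show "(1 - Inf D) * (L2_set w S)\<^sup>2 \<le> (norm (\<Sum>i\<in>S. w i *\<^sub>R column i F))\<^sup>2 \<and>
        (norm (\<Sum>i\<in>S. w i *\<^sub>R column i F))\<^sup>2 \<le> (1 + Inf D) * (L2_set w S)\<^sup>2"
      by (simp add: a_def b_def)
  qed
  moreover have "Inf D \<le> d" if "rip_bound F k d" for d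
    using that bdd by (intro cInf_lower) (simp_all add: D_def)
  ultimately have "rip_const F k = Inf D"
    unfolding rip_const_def by (intro Least_equality)
  with \<open>rip_bound F k (Inf D)\<close> show ?thesis by simp
qed

definition trusted_size :: "'m set \<Rightarrow> real ^ 'm \<Rightarrow> real \<Rightarrow> nat" where
  "trusted_size That p \<eta> = Max {card I | I. I \<subseteq> - That \<and> (\<Prod>i\<in>I. p $ i) \<ge> \<eta>}"

(* A list of all indices in descending order of p_i * qhat_i; ties may occur in any order. *)
definition descending_order :: "'m set \<Rightarrow> real ^ 'm \<Rightarrow> 'm list \<Rightarrow> bool" where
  "descending_order That p is \<longleftrightarrow>
     distinct is \<and> set is = UNIV \<and>
     sorted_wrt (\<lambda>i j. p $ i * indicator_vec That $ i \<ge> p $ j * indicator_vec That $ j) is"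

definition trusted_set :: "'m set \<Rightarrow> real ^ 'm \<Rightarrow> real \<Rightarrow> 'm list \<Rightarrow> 'm set" where
  "trusted_set That p \<eta> is = set (take (trusted_size That p \<eta>) is)"

(* L2_set over S is the Euclidean norm of the subvector with entries in S, here y_S - C_S x. *)
definition lsq_objective ::
  "real ^ 'm \<Rightarrow> real ^ 'n ^ 'm \<Rightarrow> 'm set \<Rightarrow> real ^ 'n \<Rightarrow> real" where
  "lsq_objective y C S x = 1 / 2 * (L2_set (\<lambda>i. y $ i - (C *v x) $ i) S)\<^sup>2"

definition error_bound :: "real \<Rightarrow> real \<Rightarrow> real \<Rightarrow> ereal" where
  "error_bound \<delta> \<epsilon> d =
     2 * min (ereal (\<delta> / 2)) (if d \<ge> 1 then \<infinity> else ereal (\<epsilon> / (1 - d)))"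

(* If {\<omega> \<in> space M. P \<omega>} is measurable, this says that its probability is at least r.
   No measurability is required of P, because an estimator that picks an arbitrary minimizer
   for each outcome need not be measurable. *)
definition with_prob_at_least :: "'w measure \<Rightarrow> real \<Rightarrow> ('w \<Rightarrow> bool) \<Rightarrow> bool" where
  "with_prob_at_least M r P \<longleftrightarrow>
     (\<exists>A \<in> sets M. measure M A \<ge> r \<and> (\<forall>\<omega>\<in>A. P \<omega>))"

lemma with_prob_at_least_iff:
  assumes "prob_space M" and "{\<omega> \<in> space M. P \<omega>} \<in> sets M"
  shows "with_prob_at_least M r P \<longleftrightarrow> measure M {\<omega> \<in> space M. P \<omega>} \<ge> r"
proof -
  interpret prob_space M by fact
  have le: "measure M A \<le> measure M {\<omega> \<in> space M. P \<omega>}" if "A \<in> sets M" "\<forall>\<omega>\<in>A. P \<omega>" for A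
    using that assms(2) sets.sets_into_space[OF that(1)] by (intro finite_measure_mono) blast+
  show ?thesis
  proof
    assume "with_prob_at_least M r P"
    then obtain A where "A \<in> sets M" "measure M A \<ge> r" "\<forall>\<omega>\<in>A. P \<omega>"
      unfolding with_prob_at_least_def by blast
    with le[of A] show "measure M {\<omega> \<in> space M. P \<omega>} \<ge> r" by linarith
  next
    assume "measure M {\<omega> \<in> space M. P \<omega>} \<ge> r"
    with assms(2) show "with_prob_at_least M r P"
      unfolding with_prob_at_least_def by (intro bexI[of _ "{\<omega> \<in> space M. P \<omega>}"]) simp_all
  qed
qed

end

theory Submission
  imports Defs
begin

text \<open>
  Consider the event that \<open>b i\<close> is true for every trusted index \<open>i\<close>. It has probability at least
  \<open>\<eta>\<close>, and on it the estimator sees only rows that are free of attack.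

  Its probability is the product of the \<open>p $ i\<close> over the trusted set, by independence. Among all
  sets of the same cardinality, the leading indices in descending order maximise the product of the
  sorted quantities \<open>p $ i * indicator_vec That $ i\<close>
  (\<open>prod_mono_top_set\<close>). Comparison with a set that attains the maximum \<open>trusted_size\<close> bounds this
  product below by \<open>\<eta>\<close>; as \<open>\<eta>\<close> is positive, no factor vanishes, so the trusted set avoids \<open>That\<close>
  and the product is the one of the \<open>p $ i\<close> themselves (\<open>trusted_set_props\<close>).

  On the event, the attack vanishes on the trusted rows, so there the residual of \<open>xstar\<close> is the
  noise and has norm at most \<open>\<epsilon>\<close>. The residual of the minimiser is no larger, and the triangle
  inequality bounds the trusted rows of \<open>C *v (xhat - xstar)\<close> by \<open>2 * \<epsilon>\<close>. It remains to bound these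
  rows below. The isometry constant of the transpose controls linear combinations of at most
  \<open>CARD('n)\<close> rows, that is, the adjoint of a submatrix. Choosing exactly \<open>CARD('n)\<close> trusted
  rows makes the submatrix square, and a square matrix and its adjoint share the smallest singular
  value (\<open>lower_frame_bound\<close>). This gives the factor \<open>sqrt (1 - d)\<close> with \<open>d\<close> the isometry
  constant, and \<open>sqrt (1 - d) \<ge> 1 - d\<close> because \<open>d\<close> is nonnegative.

  The condition on the size of the support, which is random, enters through its consequence that
  \<open>trusted_size\<close> is at least \<open>CARD('n)\<close>, which is deterministic. It therefore suffices that the
  condition holds for a single outcome, and the same event serves whether the condition is assumed
  almost surely or for the outcome at hand.
\<close>

section \<open>Products over the leading indices\<close>

text \<open>
  The elements of \<open>I\<close> outside \<open>S\<close> can be matched with those of \<open>S\<close> outside \<open>I\<close>, and each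
  exchange does not decrease its factor.
\<close>

lemma prod_mono_top_set:
  fixes f :: "'a \<Rightarrow> real"
  assumes "finite S" "finite I" "card I = card S"
    and nonneg: "\<And>i. f i \<ge> 0"
    and top: "\<And>i j. i \<in> S \<Longrightarrow> j \<notin> S \<Longrightarrow> f j \<le> f i"
  shows "prod f I \<le> prod f S"
proof -
  have "card (I - S) = card (S - I)"
    using assms(1-3) by (simp add: card_Diff_subset_Int Int_commute)
  then obtain h where h: "bij_betw h (I - S) (S - I)"
    using assms(1,2) finite_same_card_bij[of "I - S" "S - I"] by auto
  have "f i \<le> f (h i)" if "i \<in> I - S" for i
    using top[of "h i" i] bij_betwE[OF h] that by blast
  then have "prod f (I - S) \<le> (\<Prod>i\<in>I - S. f (h i))"
    using nonneg by (intro prod_mono) auto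
  also have "\<dots> = prod f (S - I)" by (rule prod.reindex_bij_betw[OF h])
  finally have "prod f (I \<inter> S) * prod f (I - S) \<le> prod f (S \<inter> I) * prod f (S - I)"
    using nonneg by (simp add: Int_commute mult_left_mono prod_nonneg)
  then show ?thesis
    using prod.Int_Diff[OF assms(1), of f I] prod.Int_Diff[OF assms(2), of f S] by linarith
qed

text \<open>
  The factor \<open>indicator_vec That $ i\<close> makes the sorted quantity vanish on \<open>That\<close> and agree with
  \<open>p $ i\<close> off it. So a set attaining the maximum has the same product for both quantities, the
  trusted set has at least this product for the sorted one, and positivity of that product excludes
  indices from \<open>That\<close>.
\<close>

lemma trusted_set_props:
  fixes p :: "real ^ 'm" and That :: "'m set"
  assumes pos: "\<forall>i. 0 < p $ i" and \<eta>: "0 < \<eta>" "\<eta> \<le> 1"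
    and desc: "descending_order That p is"
  shows "card (trusted_set That p \<eta> is) = trusted_size That p \<eta>"
    and "trusted_set That p \<eta> is \<subseteq> - That"
    and "(\<Prod>i\<in>trusted_set That p \<eta> is. p $ i) \<ge> \<eta>"
proof -
  define l where "l = trusted_size That p \<eta>"
  define S where "S = trusted_set That p \<eta> is"
  define f where "f i = p $ i * indicator_vec That $ i" for i
  have S_eq: "S = set (take l is)" by (simp add: S_def trusted_set_def l_def)
  have f_out: "f i = p $ i" if "i \<notin> That" for i
    using that by (simp add: f_def indicator_vec_def)
  have f_in: "f i = 0" if "i \<in> That" for i
    using that by (simp add: f_def indicator_vec_def)
  have f_nonneg: "f i \<ge> 0" for i
    using pos by (simp add: f_def indicator_vec_def less_imp_le)
  have dist: "distinct is" and all: "set is = UNIV"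
    and sorted: "sorted_wrt (\<lambda>i j. f i \<ge> f j) (take l is @ drop l is)"
    using desc by (simp_all add: descending_order_def f_def)
  define K where "K = {card I | I. I \<subseteq> - That \<and> (\<Prod>i\<in>I. p $ i) \<ge> \<eta>}"
  have "K \<subseteq> {..CARD('m)}" by (auto simp: K_def intro!: card_mono)
  then have "finite K" by (rule finite_subset) simp
  \<comment> \<open>The empty set competes in the maximum because its product is 1.\<close>
  moreover have "0 \<in> K" using \<eta> by (auto simp: K_def intro!: exI[of _ "{}"])
  ultimately have "l \<in> K"
    unfolding l_def trusted_size_def K_def[symmetric] by (intro Max_in) auto
  then obtain I where I: "I \<subseteq> - That" "(\<Prod>i\<in>I. p $ i) \<ge> \<eta>" "card I = l"
    by (auto simp: K_def)
  have "l \<le> length is"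
    using I(3) card_mono[of UNIV I] distinct_card[OF dist] all by simp
  then have card_S: "card S = l"
    using dist by (simp add: S_eq distinct_card)
  have top: "f j \<le> f i" if "i \<in> S" "j \<notin> S" for i j
  proof -
    have "j \<in> set (take l is @ drop l is)" using all by simp
    then have "j \<in> set (drop l is)" using \<open>j \<notin> S\<close> by (simp only: set_append S_eq) blast
    then show ?thesis
      using sorted \<open>i \<in> S\<close> unfolding sorted_wrt_append S_eq by blast
  qed
  have "\<eta> \<le> (\<Prod>i\<in>I. f i)"
    using I(1,2) f_out by (metis (mono_tags, lifting) ComplD prod.cong subsetD)
  also have "\<dots> \<le> prod f S"
    by (rule prod_mono_top_set) (use I card_S f_nonneg top in auto)
  finally have ge: "\<eta> \<le> prod f S" .
  have sub: "S \<subseteq> - That"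
  proof
    fix i assume "i \<in> S"
    show "i \<in> - That"
    proof
      assume "i \<in> That"
      then have "prod f S = 0" using \<open>i \<in> S\<close> f_in by (intro prod_zero) auto
      then show False using ge \<eta>(1) by linarith
    qed
  qed
  have "prod f S = (\<Prod>i\<in>S. p $ i)"
    using sub f_out by (intro prod.cong) auto
  with ge sub card_S show "card (trusted_set That p \<eta> is) = trusted_size That p \<eta>"
    "trusted_set That p \<eta> is \<subseteq> - That" "(\<Prod>i\<in>trusted_set That p \<eta> is. p $ i) \<ge> \<eta>"
    by (simp_all add: S_def l_def)
qed

section \<open>The smallest singular value of a square submatrix\<close>

text \<open>
  The hypothesis bounds the synthesis operator of the family \<open>a\<close> below, the conclusion its adjoint.
  As there are as many vectors as dimensions, the family is a basis, and \<open>h\<close> is the synthesis of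
  some \<open>w\<close>. Then \<open>h \<bullet> h\<close> is the pairing of \<open>w\<close> with the coefficients \<open>a i \<bullet> h\<close>, and the
  Cauchy--Schwarz inequality transfers the bound on \<open>w\<close> to these coefficients.
\<close>

lemma lower_frame_bound:
  fixes a :: "'i \<Rightarrow> 'a :: euclidean_space"
  assumes fin: "finite S" and card: "card S = DIM('a)" and c: "c > 0"
    and lower: "\<And>w. c * (L2_set w S)\<^sup>2 \<le> (norm (\<Sum>i\<in>S. w i *\<^sub>R a i))\<^sup>2"
  shows "c * (norm h)\<^sup>2 \<le> (L2_set (\<lambda>i. a i \<bullet> h) S)\<^sup>2"
proof -
  have zero: "w i = 0" if "(\<Sum>i\<in>S. w i *\<^sub>R a i) = 0" "i \<in> S" for w i
  proof -
    have "c * (L2_set w S)\<^sup>2 \<le> 0" using lower[of w] that(1) by simp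
    then have "(L2_set w S)\<^sup>2 \<le> 0" using c by (simp add: mult_le_0_iff)
    then show ?thesis using that(2) fin by (simp add: L2_set_eq_0_iff)
  qed
  have inj: "inj_on a S"
  proof (rule inj_onI, rule ccontr)
    fix i j assume ij: "i \<in> S" "j \<in> S" "a i = a j" "i \<noteq> j"
    define w where "w k = (if k = i then 1 else if k = j then - 1 else (0::real))" for k
    have "(\<Sum>k\<in>S. w k *\<^sub>R a k) = (\<Sum>k\<in>{i, j}. w k *\<^sub>R a k)"
      using ij fin by (intro sum.mono_neutral_right) (auto simp: w_def)
    also have "\<dots> = 0" using ij by (simp add: w_def)
    finally have "w i = 0" using zero ij(1) by blast
    then show False by (simp add: w_def)
  qed
  have "independent (a ` S)"
  proof (rule independent_if_scalars_zero)
    fix u x assume u: "(\<Sum>x\<in>a ` S. u x *\<^sub>R x) = 0" and x: "x \<in> a ` S"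
    have "(\<Sum>i\<in>S. u (a i) *\<^sub>R a i) = 0" using u inj by (simp add: sum.reindex)
    from zero[OF this] x show "u x = 0" by blast
  qed (use fin in simp)
  then have "span (a ` S) = UNIV"
    using card_image[OF inj] card
    by (metis dim_UNIV dim_eq_card_independent dim_eq_full)
  then have "h \<in> range (\<lambda>u. \<Sum>x\<in>a ` S. u x *\<^sub>R x)"
    using fin by (simp add: span_finite[symmetric])
  then obtain u where u: "h = (\<Sum>x\<in>a ` S. u x *\<^sub>R x)" by blast
  define w where "w i = u (a i)" for i
  have h: "h = (\<Sum>i\<in>S. w i *\<^sub>R a i)"
    using u inj by (simp add: sum.reindex w_def)
  define A where "A = L2_set w S"
  define B where "B = L2_set (\<lambda>i. a i \<bullet> h) S"
  have AB: "A \<ge> 0" "B \<ge> 0" by (simp_all add: A_def B_def)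
  have "(norm h)\<^sup>2 = (\<Sum>i\<in>S. w i *\<^sub>R a i) \<bullet> h"
    using h by (simp add: power2_norm_eq_inner)
  also have "\<dots> = (\<Sum>i\<in>S. w i * (a i \<bullet> h))" by (simp add: inner_sum_left)
  also have "\<dots> \<le> (\<Sum>i\<in>S. \<bar>w i\<bar> * \<bar>a i \<bullet> h\<bar>)"
    by (intro sum_mono) (metis abs_ge_self abs_mult)
  also have "\<dots> \<le> A * B" unfolding A_def B_def by (rule L2_set_mult_ineq)
  finally have hAB: "(norm h)\<^sup>2 \<le> A * B" .
  have cA: "c * A\<^sup>2 \<le> (norm h)\<^sup>2" using lower[of w] h by (simp add: A_def)
  show ?thesis
  proof (cases "h = 0")
    case False
    then have pos: "(norm h)\<^sup>2 > 0" by simp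
    have "(norm h)\<^sup>2 * (c * (norm h)\<^sup>2) = c * ((norm h)\<^sup>2)\<^sup>2"
      by (simp add: power2_eq_square)
    also have "\<dots> \<le> c * (A * B)\<^sup>2"
      using hAB c by (intro mult_left_mono power_mono) auto
    also have "\<dots> = c * A\<^sup>2 * B\<^sup>2" by (simp add: power_mult_distrib)
    also have "\<dots> \<le> (norm h)\<^sup>2 * B\<^sup>2" using cA by (intro mult_right_mono) auto
    finally show ?thesis using pos by (simp add: B_def)
  qed simp
qed

text \<open>For a single column with coefficient 1 the two-sided bound reads \<open>1 - d \<le> 1 + d\<close>.\<close>

lemma rip_const_nonneg:
  fixes F :: "real ^ 'c ^ 'r"
  assumes "k > 0"
  shows "rip_const F k \<ge> 0"
proof -
  fix c :: 'c
  have "card {c} \<le> k" using assms by simp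
  from order_trans[OF rip_boundD(1,2)[OF rip_bound_rip_const[OF assms] this, where w = "\<lambda>_. 1"]]
  show ?thesis by (simp add: L2_set_def)
qed

text \<open>
  The isometry constant only speaks of at most \<open>CARD('n)\<close> rows, and fewer rows do not determine
  \<open>h\<close>, so the bound is derived from exactly \<open>CARD('n)\<close> rows; further rows only enlarge the
  right-hand side.
\<close>

lemma rip_transpose_lower:
  fixes C :: "real ^ 'n ^ 'm"
  assumes S: "card S \<ge> CARD('n)" and d: "rip_const (transpose C) CARD('n) < 1"
  shows "(1 - rip_const (transpose C) CARD('n)) * norm h \<le> L2_set (\<lambda>i. (C *v h) $ i) S"
proof -
  define c where "c = 1 - rip_const (transpose C) CARD('n)"
  have c: "0 < c" "c \<le> 1"
    using d rip_const_nonneg[of "CARD('n)" "transpose C"] by (simp_all add: c_def)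
  obtain S' where S': "S' \<subseteq> S" "card S' = CARD('n)"
    using obtain_subset_with_card_n[OF S] by metis
  have "c * (L2_set w S')\<^sup>2 \<le> (norm (\<Sum>i\<in>S'. w i *\<^sub>R row i C))\<^sup>2" for w
    using rip_boundD(1)[OF rip_bound_rip_const, of "CARD('n)" S' "transpose C" w] S'(2)
    by (simp add: c_def column_transpose)
  then have "c * (norm h)\<^sup>2 \<le> (L2_set (\<lambda>i. row i C \<bullet> h) S')\<^sup>2"
    using S'(2) c(1) by (intro lower_frame_bound) auto
  also have "(\<lambda>i. row i C \<bullet> h) = (\<lambda>i. (C *v h) $ i)"
    by (simp add: matrix_vector_mul_component row_def)
  also have "(L2_set (\<lambda>i. (C *v h) $ i) S')\<^sup>2 \<le> (L2_set (\<lambda>i. (C *v h) $ i) S)\<^sup>2"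
    using S'(1) by (intro power_mono) (auto simp: L2_set_def sum_nonneg intro!: sum_mono2)
  finally have *: "c * (norm h)\<^sup>2 \<le> (L2_set (\<lambda>i. (C *v h) $ i) S)\<^sup>2" .
  \<comment> \<open>The sharp factor is \<open>sqrt c\<close>; as \<open>c \<le> 1\<close>, it is at least \<open>c\<close>.\<close>
  have "(c * norm h)\<^sup>2 = c * (c * (norm h)\<^sup>2)"
    by (simp add: power2_eq_square)
  also have "\<dots> \<le> 1 * (c * (norm h)\<^sup>2)" using c by (intro mult_right_mono) auto
  finally have "(c * norm h)\<^sup>2 \<le> (L2_set (\<lambda>i. (C *v h) $ i) S)\<^sup>2" using * by simp
  then show ?thesis unfolding c_def by (rule power2_le_imp_le) simp
qed

section \<open>The estimation error\<close>

lemma L2_set_le_norm: "L2_set (\<lambda>i. v $ i) S \<le> norm (v :: real ^ 'm)"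
  by (auto simp: norm_vec_def L2_set_def intro!: sum_mono2)

text \<open>
  The true state is itself admissible, so the minimiser has a residual no larger than the noise;
  the difference of the two residuals is \<open>C *v (xhat - xstar)\<close>.
\<close>

lemma lsq_error_bound:
  fixes C :: "real ^ 'n ^ 'm"
  assumes y: "y = C *v xstar + e + v" and v: "norm v \<le> \<epsilon>"
    and unattacked: "S \<inter> vec_supp e = {}" and S: "card S \<ge> CARD('n)"
    and diam: "\<forall>x1\<in>X. \<forall>x2\<in>X. norm (x1 - x2) \<le> \<delta>" and xstar: "xstar \<in> X"
    and xhat: "is_arg_min (lsq_objective y C S) (\<lambda>x. x \<in> X) xhat"
  shows "ereal (norm (xhat - xstar)) \<le> error_bound \<delta> \<epsilon> (rip_const (transpose C) CARD('n))"
proof -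
  define d where "d = rip_const (transpose C) CARD('n)"
  define r where "r x i = y $ i - (C *v x) $ i" for x i
  have "norm (xhat - xstar) \<le> \<delta>"
    using xhat xstar diam by (simp add: is_arg_min_def)
  moreover have "norm (xhat - xstar) \<le> 2 * \<epsilon> / (1 - d)" if "d < 1"
  proof -
    have "L2_set (r xhat) S \<le> L2_set (r xstar) S"
      using xhat xstar by (simp add: is_arg_min_linorder lsq_objective_def r_def[abs_def])
    moreover have "L2_set (r xstar) S = L2_set (\<lambda>i. v $ i) S"
      using unattacked by (intro L2_set_cong) (auto simp: r_def y vec_supp_def)
    then have "L2_set (r xstar) S \<le> \<epsilon>"
      using L2_set_le_norm[of v S] v by simp
    moreover have "L2_set (\<lambda>i. - r xhat i) S = L2_set (r xhat) S"
      by (simp add: L2_set_def)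
    ultimately have "L2_set (r xstar) S + L2_set (\<lambda>i. - r xhat i) S \<le> 2 * \<epsilon>"
      by linarith
    moreover have "(1 - d) * norm (xhat - xstar) \<le> L2_set (\<lambda>i. (C *v (xhat - xstar)) $ i) S"
      unfolding d_def using S that by (intro rip_transpose_lower) (simp_all add: d_def)
    moreover have "(\<lambda>i. (C *v (xhat - xstar)) $ i) = (\<lambda>i. r xstar i + - r xhat i)"
      by (simp add: r_def matrix_vector_mult_diff_distrib)
    ultimately have "(1 - d) * norm (xhat - xstar) \<le> 2 * \<epsilon>"
      using L2_set_triangle_ineq[of "r xstar" "\<lambda>i. - r xhat i" S] by simp
    then show ?thesis using that by (simp add: field_simps)
  qed
  ultimately show ?thesis
    unfolding d_def[symmetric] error_bound_def
    by (auto simp: min_def times_ereal.simps(1)[symmetric] numeral_eq_ereal)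
qed

section \<open>The event that all trusted indices are safe\<close>

lemma (in prob_space) prob_all_true:
  fixes b :: "'i \<Rightarrow> 'a \<Rightarrow> bool"
  assumes indep: "indep_vars (\<lambda>_. count_space UNIV) b UNIV" and fin: "finite S"
  shows "{\<omega> \<in> space M. \<forall>i\<in>S. b i \<omega>} \<in> sets M"
    and "prob {\<omega> \<in> space M. \<forall>i\<in>S. b i \<omega>} = (\<Prod>i\<in>S. prob {\<omega> \<in> space M. b i \<omega>})"
proof -
  have [measurable]: "b i \<in> measurable M (count_space UNIV)" for i
    using indep by (auto simp: indep_vars_def)
  show "{\<omega> \<in> space M. \<forall>i\<in>S. b i \<omega>} \<in> sets M"
    using fin by measurable
  show "prob {\<omega> \<in> space M. \<forall>i\<in>S. b i \<omega>} = (\<Prod>i\<in>S. prob {\<omega> \<in> space M. b i \<omega>})"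
  proof (cases "S = {}")
    case True
    then show ?thesis by (simp add: prob_space)
  next
    case False
    have "prob (\<Inter>i\<in>S. b i -` {True} \<inter> space M) = (\<Prod>i\<in>S. prob (b i -` {True} \<inter> space M))"
      using indep fin False by (intro indep_varsD) auto
    moreover have "(\<Inter>i\<in>S. b i -` {True} \<inter> space M) = {\<omega> \<in> space M. \<forall>i\<in>S. b i \<omega>}"
      using False by auto
    moreover have "b i -` {True} \<inter> space M = {\<omega> \<in> space M. b i \<omega>}" for i by auto
    ultimately show ?thesis by simp
  qed
qed

theorem theorem3:
  fixes M :: "'w measure"
    and C :: "real ^ 'n ^ 'm"
    and xstar :: "real ^ 'n"
    and e v y :: "'w \<Rightarrow> real ^ 'm"
    and b :: "'m \<Rightarrow> 'w \<Rightarrow> bool"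
    and p :: "real ^ 'm"
    and That :: "'m set"
    and "is" :: "'m list"
    and X :: "(real ^ 'n) set"
    and xhat :: "'w \<Rightarrow> real ^ 'n"
    and \<epsilon> \<delta> \<eta> :: real
  assumes "prob_space M"
    and "CARD('m) > CARD('n)"
    and "\<epsilon> > 0"
    and "\<forall>\<omega>\<in>space M. y \<omega> = C *v xstar + e \<omega> + v \<omega>"
    and "\<forall>\<omega>\<in>space M. norm (v \<omega>) \<le> \<epsilon>"
    and "\<forall>\<omega>\<in>space M. e \<omega> \<bullet> v \<omega> = 0"
    and "\<forall>i. 0 < p $ i \<and> p $ i < 1"
    and "prob_space.indep_vars M (\<lambda>_. count_space UNIV) b UNIV"
    and "\<forall>i. measure M {\<omega> \<in> space M. b i \<omega>} = p $ i"
    and "\<forall>\<omega>\<in>space M. \<forall>i. indicator_vec (vec_supp (e \<omega>)) $ i =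
           of_bool (b i \<omega>) * indicator_vec That $ i
             + (1 - of_bool (b i \<omega>)) * (1 - indicator_vec That $ i)"
    and "0 < \<eta>" and "\<eta> \<le> 1"
    and "descending_order That p is"
    and "\<delta> > 0"
    and "\<forall>x1\<in>X. \<forall>x2\<in>X. norm (x1 - x2) \<le> \<delta>"
    and "xstar \<in> X"
    and "\<forall>\<omega>\<in>space M.
           is_arg_min (lsq_objective (y \<omega>) C (trusted_set That p \<eta> is)) (\<lambda>x. x \<in> X) (xhat \<omega>)"
  shows "((AE \<omega> in M. int (trusted_size That p \<eta>) - int (card (vec_supp (e \<omega>))) \<ge> int CARD('n)) \<longrightarrow>
           with_prob_at_least M \<eta>
             (\<lambda>\<omega>. ereal (norm (xhat \<omega> - xstar))
                  \<le> error_bound \<delta> \<epsilon> (rip_const (transpose C) CARD('n)))) \<and>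
         with_prob_at_least M \<eta>
           (\<lambda>\<omega>. int (trusted_size That p \<eta>) - int (card (vec_supp (e \<omega>))) \<ge> int CARD('n) \<longrightarrow>
                ereal (norm (xhat \<omega> - xstar))
                  \<le> error_bound \<delta> \<epsilon> (rip_const (transpose C) CARD('n)))"
proof -
  interpret prob_space M by fact
  define S where "S = trusted_set That p \<eta> is"
  define A where "A = {\<omega> \<in> space M. \<forall>i\<in>S. b i \<omega>}"
  let ?bound = "\<lambda>\<omega>. ereal (norm (xhat \<omega> - xstar))
                  \<le> error_bound \<delta> \<epsilon> (rip_const (transpose C) CARD('n))"
  let ?cond = "\<lambda>\<omega>. int (trusted_size That p \<eta>) - int (card (vec_supp (e \<omega>))) \<ge> int CARD('n)"
  have S: "card S = trusted_size That p \<eta>" "S \<subseteq> - That" "(\<Prod>i\<in>S. p $ i) \<ge> \<eta>"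
    unfolding S_def by (rule trusted_set_props; use assms in simp)+
  have "A \<in> sets M" "prob A \<ge> \<eta>"
    using prob_all_true[OF assms(8), of S] S(3) assms(9) by (simp_all add: A_def)
  moreover have bound: "?bound \<omega>"
    if \<omega>: "\<omega> \<in> A" and size: "CARD('n) \<le> trusted_size That p \<eta>" for \<omega>
  proof -
    from \<omega> have "\<omega> \<in> space M" and safe: "\<forall>i\<in>S. b i \<omega>" by (auto simp: A_def)
    have "i \<notin> vec_supp (e \<omega>)" if "i \<in> S" for i
    proof -
      have "indicator_vec (vec_supp (e \<omega>)) $ i = indicator_vec That $ i"
        using assms(10) \<open>\<omega> \<in> space M\<close> safe that by simp
      then show ?thesis
        using S(2) that by (auto simp: indicator_vec_def split: if_splits)
    qed
    then have "S \<inter> vec_supp (e \<omega>) = {}" by blast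
    then show ?thesis
      using assms(4,5,15-17) \<open>\<omega> \<in> space M\<close> S(1) size
      by (intro lsq_error_bound[where y = "y \<omega>" and v = "v \<omega>" and S = S and X = X])
         (auto simp: S_def)
  qed
  moreover have "CARD('n) \<le> trusted_size That p \<eta>" if "?cond \<omega>" for \<omega>
    using that by linarith
  \<comment> \<open>A property that fails everywhere cannot hold almost surely in a probability space.\<close>
  moreover have "\<exists>\<omega>. ?cond \<omega>" if "AE \<omega> in M. ?cond \<omega>"
    using eventually_happens'[OF ae_filter_bot that] .
  ultimately show ?thesis
    unfolding with_prob_at_least_def by blast
qed

end
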